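(* Let $n \in \mathbb{N}$, $n \ge 1$, let $p(t) = \sum_{k=0}^m a_k t^k \in \mathbb{R}[t]$ with $a_m \neq 0$, and let $A = D_x P$ be an entrywise nonnegative $n$-by-$n$ monomial matrix, where $D_x$ is an invertible diagonal matrix and $P$ is a permutation matrix. Suppose $Q$ is a permutation matrix such that $$Q^\top A Q = \bigoplus_{i=1}^k K_{y_i},$$ where $1 \le k \le n$, $y = Q^\top x$, and $y$ is partitioned into $k$ consecutive blocks $y_i \in \mathbb{C}^{n_i}$ of sizes $n_i$, $i \in \{1,\ldots,k\}$. Then $$p(A) = Q \left( \bigoplus_{i=1}^k \sum_{r=0}^{n_i-1} \frac{p_{(r,n_i)}\left(\alpha_{y_i}^{1/n_i}\right)}{\alpha_{y_i}^{r/n_i}} K_{y_i}^r \right) Q^\top.$$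
   Context: For $\ell \ge 1$ and $z = (z_1,\ldots,z_\ell) \in \mathbb{C}^\ell$: $D_z$ is the diagonal matrix whose $j$th diagonal entry is $z_j$; $\alpha_z = \prod_{j=1}^\ell z_j$; $C_\ell$ is the $\ell$-by-$\ell$ permutation matrix whose $(i,j)$-entry is $\delta_{\pi(i),j}$ (Kronecker delta), where $\pi(i) = (i \bmod \ell) + 1$ on $\{1,\ldots,\ell\}$; and $K_z = D_z C_\ell$. A matrix is monomial if it is the product $DP$ of an invertible diagonal matrix $D$ and a permutation matrix $P$. The block sizes satisfy $n_i \ge 1$ and $n_1+\cdots+n_k = n$. For $\ell \ge 1$ and $r \in \{0,\ldots,\ell-1\}$, the $r \bmod \ell$-part of $p(t)=\sum_{j=0}^m a_j t^j$ is $$p_{(r,\ell)}(t) = \sum_{\substack{0 \le j \le m \\ j \bmod \ell = r}} a_j t^j,$$ where an empty sum is the zero polynomial. Real powers of the positive numbers $\alpha_{y_i}$ are the positive ones. *)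

theory Defs
  imports
    Jordan_Normal_Form.Matrix
    "HOL-Computational_Algebra.Polynomial"
    "HOL-Combinatorics.Permutations"
    "HOL-Library.Nonpos_Ints"
begin

text \<open>
  Vector and matrix indices start at \<open>0\<close>, so the index set \<open>{1,\<dots>,n}\<close> of the mathematical
  text becomes \<open>{..<n}\<close>.
\<close>

definition diag_mat_of_vec :: "'a::zero vec \<Rightarrow> 'a mat" where
  "diag_mat_of_vec z = mat_diag (dim_vec z) (\<lambda>j. z $ j)"

definition vec_prod :: "'a::comm_monoid_mult vec \<Rightarrow> 'a" where
  "vec_prod z = (\<Prod>j<dim_vec z. z $ j)"

definition mat_of_perm :: "nat \<Rightarrow> (nat \<Rightarrow> nat) \<Rightarrow> 'a::zero_neq_one mat" where
  "mat_of_perm n \<sigma> = mat n n (\<lambda>(i, j). if \<sigma> i = j then 1 else 0)"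

definition permutation_mat :: "nat \<Rightarrow> 'a::zero_neq_one mat \<Rightarrow> bool" where
  "permutation_mat n P \<longleftrightarrow> (\<exists>\<sigma>. \<sigma> permutes {..<n} \<and> P = mat_of_perm n \<sigma>)"

text \<open>
  The shift \<open>i \<mapsto> (i mod l) + 1\<close> of \<open>{1,\<dots>,l}\<close> is \<open>i \<mapsto> (i + 1) mod l\<close> on \<open>{..<l}\<close>.
\<close>

definition cyclic_perm_mat :: "nat \<Rightarrow> 'a::zero_neq_one mat" where
  "cyclic_perm_mat l = mat_of_perm l (\<lambda>i. (i + 1) mod l)"

definition K_mat :: "'a::semiring_1 vec \<Rightarrow> 'a mat" where
  "K_mat z = diag_mat_of_vec z * cyclic_perm_mat (dim_vec z)"

text \<open>The \<open>i\<close>-th of consecutive blocks of \<open>y\<close> with sizes \<open>ns 0, ns 1, \<dots>\<close>.\<close>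

definition vec_block :: "'a vec \<Rightarrow> (nat \<Rightarrow> nat) \<Rightarrow> nat \<Rightarrow> 'a vec" where
  "vec_block y ns i = vec (ns i) (\<lambda>j. y $ ((\<Sum>l<i. ns l) + j))"

definition direct_sum_mat :: "nat \<Rightarrow> (nat \<Rightarrow> 'a::zero mat) \<Rightarrow> 'a mat" where
  "direct_sum_mat k B = diag_block_mat (map B [0..<k])"

definition nonneg_complex_mat :: "complex mat \<Rightarrow> bool" where
  "nonneg_complex_mat A \<longleftrightarrow>
     (\<forall>i<dim_row A. \<forall>j<dim_col A. A $$ (i, j) \<in> \<real>\<^sub>\<ge>\<^sub>0)"

definition mod_part :: "'a::comm_monoid_add poly \<Rightarrow> nat \<Rightarrow> nat \<Rightarrow> 'a poly" where
  "mod_part p r l = (\<Sum>j | j \<le> degree p \<and> j mod l = r. monom (coeff p j) j)"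

text \<open>
  Matrices of the type \<^typ>\<open>'a mat\<close> carry their dimensions and have no zero of their own, so a
  sum of \<open>n\<close>-by-\<open>n\<close> matrices over an index set is formed entrywise.
\<close>

definition mat_sum :: "nat \<Rightarrow> ('i \<Rightarrow> 'a::comm_monoid_add mat) \<Rightarrow> 'i set \<Rightarrow> 'a mat" where
  "mat_sum n F S = mat n n (\<lambda>(i, j). \<Sum>s\<in>S. F s $$ (i, j))"

definition poly_mat :: "real poly \<Rightarrow> complex mat \<Rightarrow> complex mat" where
  "poly_mat p A =
     mat_sum (dim_row A) (\<lambda>j. complex_of_real (coeff p j) \<cdot>\<^sub>m (A ^\<^sub>m j)) {..degree p}"

end

theory Submission
  imports
    Defs
    "HOL-Number_Theory.Cong"
begin

text \<open>
  The entry of \<open>K\<^sub>z\<close> to the power \<open>m\<close> in row \<open>i\<close> is a product of \<open>m\<close> cyclically consecutive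
  entries of \<open>z\<close>, so \<open>K\<^sub>z\<close> to the power \<open>l = dim_vec z\<close> is the scalar matrix \<open>\<alpha>\<^sub>z\<close>. Hence
  the \<open>j\<close>-th power of \<open>K\<^sub>z\<close> is \<open>\<alpha>\<^sub>z ^ (j div l)\<close> times its \<open>j mod l\<close>-th power, and grouping the
  monomials of \<open>p\<close> by \<open>j mod l\<close> gives the formula on one block. Polynomials commute with direct
  sums and with conjugation by \<open>Q\<close>, and nonnegativity together with invertibility of \<open>D\<^sub>x\<close> makes
  every \<open>\<alpha>\<close> a positive real.
\<close>

section \<open>Permutation matrices\<close>

lemma mat_of_perm_carrier [simp]: "mat_of_perm n \<sigma> \<in> carrier_mat n n"
  by (simp add: mat_of_perm_def)

lemma mat_of_perm_transpose_mult:
  fixes \<sigma> :: "nat \<Rightarrow> nat"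
  assumes "\<sigma> permutes {..<n}"
  shows "mat_of_perm n \<sigma> * transpose_mat (mat_of_perm n \<sigma>) = (1\<^sub>m n :: 'a::semiring_1 mat)"
    and "transpose_mat (mat_of_perm n \<sigma>) * mat_of_perm n \<sigma> = (1\<^sub>m n :: 'a::semiring_1 mat)"
proof -
  have lt: "\<sigma> i < n" if "i < n" for i
    using permutes_in_image[OF assms] that by simp
  have inj: "\<sigma> i = \<sigma> j \<longleftrightarrow> i = j" for i j
    using permutes_inj[OF assms] by (auto dest: injD)
  show "mat_of_perm n \<sigma> * transpose_mat (mat_of_perm n \<sigma>) = (1\<^sub>m n :: 'a mat)"
    by (rule eq_matI)
      (auto simp: mat_of_perm_def scalar_prod_def if_distrib[of "\<lambda>t. t * _"] lt inj cong: if_cong)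
  show "transpose_mat (mat_of_perm n \<sigma>) * mat_of_perm n \<sigma> = (1\<^sub>m n :: 'a mat)"
  proof (rule eq_matI)
    fix i j assume "i < dim_row (1\<^sub>m n :: 'a mat)" "j < dim_col (1\<^sub>m n :: 'a mat)"
    then have ij: "i < n" "j < n" by auto
    have "(transpose_mat (mat_of_perm n \<sigma>) * mat_of_perm n \<sigma>) $$ (i, j)
        = (\<Sum>t\<in>{..<n}. (if \<sigma> t = i then 1 else 0) * (if \<sigma> t = j then 1 else 0 :: 'a))"
      using ij by (simp add: mat_of_perm_def scalar_prod_def atLeast0LessThan)
    \<comment> \<open>In this order the summation index stands under \<open>\<sigma>\<close> in both
      factors, so the sum is reindexed along the bijection. The other order compares
      \<open>\<sigma> i\<close> with \<open>\<sigma> j\<close> and rests on injectivity.\<close>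
    also have "\<dots> = (\<Sum>s\<in>{..<n}. (if s = i then 1 else 0) * (if s = j then 1 else 0))"
      by (rule sum.reindex_bij_betw[OF permutes_imp_bij[OF assms]])
    also have "\<dots> = (1\<^sub>m n :: 'a mat) $$ (i, j)"
      using ij by (simp add: if_distrib[of "\<lambda>t. t * _"] cong: if_cong)
    finally show "(transpose_mat (mat_of_perm n \<sigma>) * mat_of_perm n \<sigma>) $$ (i, j)
        = (1\<^sub>m n :: 'a mat) $$ (i, j)" .
  qed (auto simp: mat_of_perm_def)
qed

text \<open>Column \<open>\<sigma> i\<close> of the permutation matrix has its only one in row
  \<open>i\<close>, so the transpose merely moves entries. In the theorem this carries sign and
  nonvanishing from \<open>x\<close> to \<open>y\<close>.\<close>

lemma transpose_mat_of_perm_mult_vec_index: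
  fixes x :: "'a::semiring_1 vec"
  assumes "\<sigma> permutes {..<n}" and "x \<in> carrier_vec n" and "i < n"
  shows "(transpose_mat (mat_of_perm n \<sigma>) *\<^sub>v x) $ (\<sigma> i) = x $ i"
proof -
  have "\<sigma> i < n" "\<And>j. \<sigma> j = \<sigma> i \<longleftrightarrow> j = i"
    using permutes_in_image[OF assms(1)] permutes_inj[OF assms(1)] assms(3) by (auto dest: injD)
  then show ?thesis
    using assms(2,3)
    by (auto simp: mat_of_perm_def scalar_prod_def if_distrib[of "\<lambda>t. t * _"] cong: if_cong)
qed

section \<open>Entrywise sums and direct sums of matrices\<close>

lemma mat_sum_mult_left:
  fixes Q :: "'a::semiring_0 mat"
  assumes "Q \<in> carrier_mat n n" and "\<And>s. s \<in> S \<Longrightarrow> F s \<in> carrier_mat n n"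
  shows "mat_sum n (\<lambda>s. Q * F s) S = Q * mat_sum n F S"
proof (rule eq_matI)
  fix i j assume "i < dim_row (Q * mat_sum n F S)" "j < dim_col (Q * mat_sum n F S)"
  then have ij: "i < n" "j < n" using assms(1) by (auto simp: mat_sum_def)
  have F: "dim_row (F s) = n" "dim_col (F s) = n" if "s \<in> S" for s
    using assms(2)[OF that] by auto
  have "mat_sum n (\<lambda>s. Q * F s) S $$ (i, j) = (\<Sum>s\<in>S. \<Sum>t<n. Q $$ (i, t) * F s $$ (t, j))"
    using ij assms(1) F
    by (auto simp: mat_sum_def scalar_prod_def atLeast0LessThan intro!: sum.cong)
  also have "\<dots> = (\<Sum>t<n. Q $$ (i, t) * (\<Sum>s\<in>S. F s $$ (t, j)))"
    by (subst sum.swap) (simp add: sum_distrib_left)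
  also have "\<dots> = (Q * mat_sum n F S) $$ (i, j)"
    using ij assms(1) F
    by (auto simp: mat_sum_def scalar_prod_def atLeast0LessThan intro!: sum.cong)
  finally show "mat_sum n (\<lambda>s. Q * F s) S $$ (i, j) = (Q * mat_sum n F S) $$ (i, j)" .
qed (use assms in \<open>auto simp: mat_sum_def\<close>)

lemma mat_sum_mult_right:
  fixes Q :: "'a::semiring_0 mat"
  assumes "Q \<in> carrier_mat n n" and "\<And>s. s \<in> S \<Longrightarrow> F s \<in> carrier_mat n n"
  shows "mat_sum n (\<lambda>s. F s * Q) S = mat_sum n F S * Q"
proof (rule eq_matI)
  fix i j assume "i < dim_row (mat_sum n F S * Q)" "j < dim_col (mat_sum n F S * Q)"
  then have ij: "i < n" "j < n" using assms(1) by (auto simp: mat_sum_def)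
  have F: "dim_row (F s) = n" "dim_col (F s) = n" if "s \<in> S" for s
    using assms(2)[OF that] by auto
  have "mat_sum n (\<lambda>s. F s * Q) S $$ (i, j) = (\<Sum>s\<in>S. \<Sum>t<n. F s $$ (i, t) * Q $$ (t, j))"
    using ij assms(1) F
    by (auto simp: mat_sum_def scalar_prod_def atLeast0LessThan intro!: sum.cong)
  also have "\<dots> = (\<Sum>t<n. (\<Sum>s\<in>S. F s $$ (i, t)) * Q $$ (t, j))"
    by (subst sum.swap) (simp add: sum_distrib_right)
  also have "\<dots> = (mat_sum n F S * Q) $$ (i, j)"
    using ij assms(1) F
    by (auto simp: mat_sum_def scalar_prod_def atLeast0LessThan intro!: sum.cong)
  finally show "mat_sum n (\<lambda>s. F s * Q) S $$ (i, j) = (mat_sum n F S * Q) $$ (i, j)" .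
qed (use assms in \<open>auto simp: mat_sum_def\<close>)

lemma direct_sum_mat_0: "direct_sum_mat 0 B = 0\<^sub>m 0 0"
  by (simp add: direct_sum_mat_def)

text \<open>\<open>diag_block_mat\<close> recurses from the front of its list. Splitting off the
  last block instead matches sums over \<open>{..<k}\<close> and allows induction on
  \<open>k\<close>.\<close>

lemma direct_sum_mat_Suc:
  "direct_sum_mat (Suc k) B = four_block_mat (direct_sum_mat k B)
     (0\<^sub>m (dim_row (direct_sum_mat k B)) (dim_col (B k)))
     (0\<^sub>m (dim_row (B k)) (dim_col (direct_sum_mat k B))) (B k)"
  by (simp add: direct_sum_mat_def diag_block_mat_last Let_def)

lemma direct_sum_mat_cong:
  "(\<And>i. i < k \<Longrightarrow> B i = C i) \<Longrightarrow> direct_sum_mat k B = direct_sum_mat k C"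
  unfolding direct_sum_mat_def by (intro arg_cong[of _ _ diag_block_mat]) simp

lemma direct_sum_mat_carrier:
  assumes "\<And>i. i < k \<Longrightarrow> B i \<in> carrier_mat (ns i) (ns i)"
  shows "direct_sum_mat k B \<in> carrier_mat (\<Sum>i<k. ns i) (\<Sum>i<k. ns i)"
  using assms by (induction k) (auto simp: direct_sum_mat_0 direct_sum_mat_Suc)

lemma direct_sum_mat_smult:
  fixes B :: "nat \<Rightarrow> 'a::mult_zero mat"
  shows "c \<cdot>\<^sub>m direct_sum_mat k B = direct_sum_mat k (\<lambda>i. c \<cdot>\<^sub>m B i)"
proof (induction k)
  case (Suc k)
  \<comment> \<open>The zero blocks are sized by the partial direct sums, so these dimensions must
    agree first; the induction hypothesis read from right to left gives this.\<close>
  have "dim_row (direct_sum_mat k (\<lambda>i. c \<cdot>\<^sub>m B i)) = dim_row (direct_sum_mat k B)"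
    "dim_col (direct_sum_mat k (\<lambda>i. c \<cdot>\<^sub>m B i)) = dim_col (direct_sum_mat k B)"
    by (simp_all flip: Suc)
  then show ?case
    by (auto simp: direct_sum_mat_Suc simp flip: Suc intro!: eq_matI)
qed (auto simp: direct_sum_mat_0)

lemma direct_sum_mat_pow:
  assumes "\<And>i. i < k \<Longrightarrow> square_mat (B i)"
  shows "direct_sum_mat k B ^\<^sub>m j = direct_sum_mat k (\<lambda>i. B i ^\<^sub>m j)"
  using assms unfolding direct_sum_mat_def by (subst diag_block_pow_mat) (auto simp: o_def)

text \<open>Since \<open>ns i\<close> does not depend on \<open>s\<close>, all summands have the
  same block boundaries, and outside the blocks only zeros are added.\<close>

lemma mat_sum_direct_sum_mat:
  assumes "\<And>i s. i < k \<Longrightarrow> s \<in> S \<Longrightarrow> F s i \<in> carrier_mat (ns i) (ns i)"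
  shows "mat_sum (\<Sum>i<k. ns i) (\<lambda>s. direct_sum_mat k (F s)) S
    = direct_sum_mat k (\<lambda>i. mat_sum (ns i) (\<lambda>s. F s i) S)"
  using assms
proof (induction k)
  case 0
  show ?case by (auto simp: direct_sum_mat_0 mat_sum_def)
next
  case (Suc k)
  let ?n = "\<Sum>i<k. ns i"
  have dim: "dim_row (direct_sum_mat k (F s)) = ?n" "dim_col (direct_sum_mat k (F s)) = ?n"
    "dim_row (F s k) = ns k" "dim_col (F s k) = ns k" if "s \<in> S" for s
    using direct_sum_mat_carrier[of k "F s" ns] Suc.prems that by auto
  have IH: "direct_sum_mat k (\<lambda>i. mat_sum (ns i) (\<lambda>s. F s i) S)
      = mat_sum ?n (\<lambda>s. direct_sum_mat k (F s)) S"
    using Suc by simp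
  show ?case
    unfolding direct_sum_mat_Suc IH
    by (rule eq_matI) (auto simp: mat_sum_def dim)
qed

section \<open>Powers of \<open>K_mat\<close>\<close>

lemma K_mat_carrier [simp]: "K_mat z \<in> carrier_mat (dim_vec z) (dim_vec z)"
  unfolding K_mat_def diag_mat_of_vec_def cyclic_perm_mat_def
  by (rule mult_carrier_mat[OF mat_diag_dim mat_of_perm_carrier])

lemma K_mat_index:
  assumes "i < dim_vec z" and "j < dim_vec z"
  shows "K_mat z $$ (i, j) = (if (i + 1) mod dim_vec z = j then z $ i else 0)"
  using assms
  by (auto simp: K_mat_def diag_mat_of_vec_def cyclic_perm_mat_def
      mat_diag_mult_left[of _ "dim_vec z" "dim_vec z"] mat_of_perm_def)

text \<open>\<open>K_mat z\<close> is the weighted adjacency matrix of a directed cycle: the only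
  walk of length \<open>m\<close> from \<open>i\<close> goes through \<open>i\<close>,
  \<open>i + 1\<close>, ... modulo the length, and the entry is its weight.\<close>

lemma K_mat_pow_index:
  fixes z :: "'a::comm_semiring_1 vec"
  assumes "i < dim_vec z" and "j < dim_vec z"
  shows "(K_mat z ^\<^sub>m m) $$ (i, j) =
    (if (i + m) mod dim_vec z = j then \<Prod>t<m. z $ ((i + t) mod dim_vec z) else 0)"
  using assms(2)
proof (induction m arbitrary: j)
  case 0
  then show ?case using assms carrier_matD[OF K_mat_carrier[of z]] by auto
next
  case (Suc m)
  let ?l = "dim_vec z"
  let ?w = "\<Prod>t<m. z $ ((i + t) mod ?l)"
  have l: "0 < ?l" using assms by simp
  have d: "dim_row (K_mat z) = ?l" "dim_col (K_mat z) = ?l"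
    using carrier_matD[OF K_mat_carrier[of z]] by auto
  have "(K_mat z ^\<^sub>m Suc m) $$ (i, j) = (\<Sum>s<?l. (K_mat z ^\<^sub>m m) $$ (i, s) * K_mat z $$ (s, j))"
    using assms(1) Suc.prems d by (auto simp: scalar_prod_def atLeast0LessThan intro!: sum.cong)
  \<comment> \<open>The induction hypothesis, available for every column, leaves only the endpoint
    of the walk of length \<open>m\<close>.\<close>
  also have "\<dots> = (\<Sum>s<?l. if (i + m) mod ?l = s then ?w * K_mat z $$ (s, j) else 0)"
    by (rule sum.cong) (auto simp: Suc.IH)
  also have "\<dots> = ?w * K_mat z $$ ((i + m) mod ?l, j)"
    using l by (simp add: sum.delta)
  also have "\<dots> = (if (i + Suc m) mod ?l = j then ?w * z $ ((i + m) mod ?l) else 0)"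
    using l Suc.prems by (simp add: K_mat_index mod_Suc_eq)
  finally show ?case by simp
qed

text \<open>Translation by \<open>i\<close> is injective modulo \<open>l\<close>, hence a bijection
  of the finite set of residues. Thus one full turn of the cycle has the same weight from every
  starting row.\<close>

lemma prod_cyclic_shift:
  fixes f :: "nat \<Rightarrow> 'a::comm_monoid_mult"
  assumes "0 < l"
  shows "(\<Prod>t<l. f ((i + t) mod l)) = (\<Prod>t<l. f t)"
proof -
  have "inj_on (\<lambda>t. (i + t) mod l) {..<l}"
  proof (rule inj_onI)
    fix s t assume st: "s \<in> {..<l}" "t \<in> {..<l}" and "(i + s) mod l = (i + t) mod l"
    then have "[i + s = i + t] (mod l)" by (simp add: cong_def)
    then have "[s = t] (mod l)" by (simp only: cong_add_lcancel_nat)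
    then show "s = t" using st by (simp add: cong_def)
  qed
  then have "bij_betw (\<lambda>t. (i + t) mod l) {..<l} {..<l}"
    using assms by (intro bij_betw_imageI endo_inj_surj) auto
  then show ?thesis by (rule prod.reindex_bij_betw)
qed

text \<open>Each full turn of the cycle contributes the factor \<open>vec_prod z\<close> and leads
  back to the same column, so only the remaining \<open>r\<close> steps matter.\<close>

lemma K_mat_pow_reduce:
  fixes z :: "'a::comm_semiring_1 vec"
  shows "K_mat z ^\<^sub>m (q * dim_vec z + r) = vec_prod z ^ q \<cdot>\<^sub>m (K_mat z ^\<^sub>m r)"
proof (rule eq_matI)
  let ?l = "dim_vec z"
  have d: "dim_row (K_mat z) = ?l" "dim_col (K_mat z) = ?l"
    using carrier_matD[OF K_mat_carrier[of z]] by auto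
  fix i j assume "i < dim_row (vec_prod z ^ q \<cdot>\<^sub>m (K_mat z ^\<^sub>m r))"
    and "j < dim_col (vec_prod z ^ q \<cdot>\<^sub>m (K_mat z ^\<^sub>m r))"
  then have ij: "i < ?l" "j < ?l" using d by (auto split: if_splits)
  have "(\<Prod>t<q * ?l + r. z $ ((i + t) mod ?l)) = vec_prod z ^ q * (\<Prod>t<r. z $ ((i + t) mod ?l))"
  proof (induction q)
    case (Suc q)
    \<comment> \<open>This splits off the first full turn; by periodicity the remaining factors are
      those of the induction hypothesis.\<close>
    have *: "(\<Prod>t<?l + m. g t) = (\<Prod>t<?l. g t) * (\<Prod>t<m. g (?l + t))"
      for m and g :: "nat \<Rightarrow> 'a"
      by (induction m) (simp_all add: ac_simps)
    have "(\<Prod>t<Suc q * ?l + r. z $ ((i + t) mod ?l))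
        = (\<Prod>t<?l. z $ ((i + t) mod ?l)) * (\<Prod>t<q * ?l + r. z $ ((i + (?l + t)) mod ?l))"
      using *[of "\<lambda>t. z $ ((i + t) mod ?l)" "q * ?l + r"] by (simp add: add.assoc)
    also have "(\<Prod>t<?l. z $ ((i + t) mod ?l)) = vec_prod z"
      using ij by (simp add: vec_prod_def prod_cyclic_shift)
    also have "(\<Prod>t<q * ?l + r. z $ ((i + (?l + t)) mod ?l))
        = (\<Prod>t<q * ?l + r. z $ ((i + t) mod ?l))"
    proof -
      have "(i + (?l + t)) mod ?l = (i + t) mod ?l" for t
        by (metis add.left_commute mod_add_self1)
      then show ?thesis by simp
    qed
    finally show ?case by (simp only: Suc.IH power_Suc mult.assoc)
  qed simp
  moreover have "(i + (q * ?l + r)) mod ?l = (i + r) mod ?l"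
    by (metis add.left_commute mod_mult_self3)
  ultimately have "(K_mat z ^\<^sub>m (q * ?l + r)) $$ (i, j)
      = vec_prod z ^ q * (K_mat z ^\<^sub>m r) $$ (i, j)"
    unfolding K_mat_pow_index[OF ij] by (simp only: if_distrib[of "(*) _"] mult_zero_right)
  then show "(K_mat z ^\<^sub>m (q * ?l + r)) $$ (i, j)
      = (vec_prod z ^ q \<cdot>\<^sub>m (K_mat z ^\<^sub>m r)) $$ (i, j)"
    using ij d by simp
qed (use carrier_matD[OF K_mat_carrier[of z]] in auto)

section \<open>Residue classes of exponents and the formula on one block\<close>

lemma poly_mod_part_divide:
  fixes p :: "real poly"
  assumes "0 < \<alpha>" and "0 < l"
  shows "poly (mod_part p r l) (\<alpha> powr (1 / real l)) / \<alpha> powr (real r / real l)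
    = (\<Sum>j | j \<le> degree p \<and> j mod l = r. coeff p j * \<alpha> ^ (j div l))"
proof -
  \<comment> \<open>For \<open>j = q * l + r\<close> the exponent \<open>j / l - r / l\<close> is
    the integer \<open>q\<close>, so the roots cancel and the factor \<open>\<alpha> ^ q\<close> of
    \<open>K_mat_pow_reduce\<close> appears.\<close>
  have *: "(\<alpha> powr (1 / real l)) ^ j / \<alpha> powr (real r / real l) = \<alpha> ^ (j div l)"
    if "j mod l = r" for j
  proof -
    have "real j = real (j div l) * real l + real r"
      using that by (metis div_mult_mod_eq of_nat_add of_nat_mult)
    then have "real j / real l - real r / real l = real (j div l)"
      using assms(2) by (simp add: field_simps)
    moreover have "(\<alpha> powr (1 / real l)) ^ j = \<alpha> powr (real j / real l)"
      using assms(1) by (simp add: powr_powr flip: powr_realpow)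
    ultimately show ?thesis
      using assms(1) by (simp add: powr_realpow flip: powr_diff)
  qed
  show ?thesis
    unfolding mod_part_def poly_sum poly_monom sum_divide_distrib
    by (rule sum.cong) (auto simp: * simp flip: times_divide_eq_right)
qed

text \<open>Real powers need a real base, so \<open>\<alpha>\<close> is a separate real number
  identified with the complex product \<open>vec_prod z\<close>.\<close>

lemma poly_mat_K_mat:
  fixes z :: "complex vec"
  assumes "0 < dim_vec z" and "vec_prod z = complex_of_real \<alpha>" and "0 < \<alpha>"
  shows "mat_sum (dim_vec z) (\<lambda>j. complex_of_real (coeff p j) \<cdot>\<^sub>m (K_mat z ^\<^sub>m j)) {..degree p}
    = mat_sum (dim_vec z)
        (\<lambda>r. complex_of_real (poly (mod_part p r (dim_vec z)) (\<alpha> powr (1 / real (dim_vec z)))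
               / \<alpha> powr (real r / real (dim_vec z))) \<cdot>\<^sub>m (K_mat z ^\<^sub>m r)) {0..<dim_vec z}"
    (is "?lhs = ?rhs")
proof (rule eq_matI)
  let ?l = "dim_vec z"
  have d: "dim_row (K_mat z) = ?l" "dim_col (K_mat z) = ?l"
    using carrier_matD[OF K_mat_carrier[of z]] by auto
  fix a b assume "a < dim_row ?rhs" "b < dim_col ?rhs"
  then have ab: "a < ?l" "b < ?l" by (auto simp: mat_sum_def)
  let ?f = "\<lambda>j. complex_of_real (coeff p j) * (K_mat z ^\<^sub>m j) $$ (a, b)"
  have red: "(K_mat z ^\<^sub>m j) $$ (a, b)
      = complex_of_real (\<alpha> ^ (j div ?l)) * (K_mat z ^\<^sub>m (j mod ?l)) $$ (a, b)" for j
    using K_mat_pow_reduce[of z "j div ?l" "j mod ?l"] ab d assms(2) by simp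
  have "?lhs $$ (a, b) = sum ?f {..degree p}"
    using ab d by (simp add: mat_sum_def)
  \<comment> \<open>The exponents are partitioned by residue; positivity of the length puts every
    residue in \<open>{0..<?l}\<close>.\<close>
  also have "\<dots> = (\<Sum>r\<in>{0..<?l}. sum ?f {j \<in> {..degree p}. j mod ?l = r})"
    by (rule sum.group[symmetric]) (use assms(1) in auto)
  also have "\<dots> = (\<Sum>r\<in>{0..<?l}. (\<Sum>j | j \<le> degree p \<and> j mod ?l = r.
      complex_of_real (coeff p j * \<alpha> ^ (j div ?l))) * (K_mat z ^\<^sub>m r) $$ (a, b))"
  proof (rule sum.cong[OF refl], unfold sum_distrib_right, rule sum.cong)
    fix r j
    assume "j \<in> {j. j \<le> degree p \<and> j mod ?l = r}"
    then show "?f j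
        = complex_of_real (coeff p j * \<alpha> ^ (j div ?l)) * (K_mat z ^\<^sub>m r) $$ (a, b)"
      using red[of j] by simp
  qed auto
  also have "\<dots> = ?rhs $$ (a, b)"
    using ab d assms by (simp add: mat_sum_def poly_mod_part_divide del: of_real_mult of_real_power)
  finally show "?lhs $$ (a, b) = ?rhs $$ (a, b)" .
qed (auto simp: mat_sum_def)

section \<open>Positivity of the entries and of the block products\<close>

lemma invertible_diag_mat_of_vec_nonzero:
  assumes "invertible_mat (diag_mat_of_vec x)" and "i < dim_vec x"
  shows "x $ i \<noteq> 0"
proof -
  let ?D = "diag_mat_of_vec x"
  obtain B where DB: "?D * B = 1\<^sub>m (dim_row ?D)" and BD: "B * ?D = 1\<^sub>m (dim_row B)"
    using assms(1) unfolding invertible_mat_def inverts_mat_def by blast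
  have d: "dim_row ?D = dim_vec x" "dim_col ?D = dim_vec x"
    by (simp_all add: diag_mat_of_vec_def mat_diag_def)
  \<comment> \<open>The inverse comes without dimensions; comparing column counts in the two product
    equations makes it square of the right size. Its \<open>(i, i)\<close> entry times
    \<open>x $ i\<close> is then one.\<close>
  have "dim_col B = dim_vec x" "dim_row B = dim_vec x"
    using arg_cong[OF DB, of dim_col] arg_cong[OF BD, of dim_col] d by simp_all
  then have "B \<in> carrier_mat (dim_vec x) (dim_vec x)" by auto
  then have "(?D * B) $$ (i, i) = x $ i * B $$ (i, i)"
    using assms(2) by (simp add: diag_mat_of_vec_def mat_diag_mult_left)
  then show ?thesis using DB d assms(2) by auto
qed

text \<open>Row \<open>i\<close> of the product carries \<open>x $ i\<close> in column
  \<open>\<sigma> i\<close>, so nonnegativity of the matrix passes to the vector.\<close>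

lemma diag_mat_of_vec_mult_perm_nonneg:
  assumes "permutation_mat n P" and "x \<in> carrier_vec n"
    and "nonneg_complex_mat (diag_mat_of_vec x * P)" and "i < n"
  shows "x $ i \<in> \<real>\<^sub>\<ge>\<^sub>0"
proof -
  obtain \<sigma> where \<sigma>: "\<sigma> permutes {..<n}" "P = mat_of_perm n \<sigma>"
    using assms(1) by (auto simp: permutation_mat_def)
  have "\<sigma> i < n" using permutes_in_image[OF \<sigma>(1)] assms(4) by simp
  moreover have "diag_mat_of_vec x * P = mat n n (\<lambda>(i, j). x $ i * P $$ (i, j))"
    using assms(2) unfolding \<sigma>(2) diag_mat_of_vec_def
    by (subst mat_diag_mult_left[of _ _ n]) auto
  ultimately have "(diag_mat_of_vec x * P) $$ (i, \<sigma> i) = x $ i"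
    "i < dim_row (diag_mat_of_vec x * P)" "\<sigma> i < dim_col (diag_mat_of_vec x * P)"
    using assms(4) by (simp_all add: \<sigma>(2) mat_of_perm_def)
  then show ?thesis
    using assms(3) unfolding nonneg_complex_mat_def by metis
qed

text \<open>Nonnegative reals are closed under products, and a product of nonzero numbers is
  nonzero. This justifies using the real part of \<open>vec_prod z\<close> as the base of real
  powers.\<close>

lemma vec_prod_pos_real:
  fixes z :: "complex vec"
  assumes "\<And>j. j < dim_vec z \<Longrightarrow> z $ j \<in> \<real>\<^sub>\<ge>\<^sub>0" and "\<And>j. j < dim_vec z \<Longrightarrow> z $ j \<noteq> 0"
  shows "vec_prod z = complex_of_real (Re (vec_prod z))" and "0 < Re (vec_prod z)"
proof -
  have "(\<Prod>j<m. z $ j) \<in> \<real>\<^sub>\<ge>\<^sub>0" if "m \<le> dim_vec z" for m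
    using that by (induction m) (auto intro!: nonneg_Reals_mult_I assms(1))
  then have "vec_prod z \<in> \<real>\<^sub>\<ge>\<^sub>0" by (simp add: vec_prod_def)
  moreover have "vec_prod z \<noteq> 0" using assms(2) by (simp add: vec_prod_def)
  ultimately show "vec_prod z = complex_of_real (Re (vec_prod z))" "0 < Re (vec_prod z)"
    by (auto elim!: nonneg_Reals_cases simp: order_less_le)
qed

text \<open>Offset plus size of block \<open>i\<close> is the next offset, which is at most the
  total. So \<open>vec_block\<close> reads only indices inside \<open>y\<close>.\<close>

lemma sum_block_offset_less:
  fixes ns :: "nat \<Rightarrow> nat"
  assumes "i < k" and "j < ns i"
  shows "(\<Sum>l<i. ns l) + j < (\<Sum>l<k. ns l)"
proof -
  have "(\<Sum>l<Suc i. ns l) \<le> (\<Sum>l<k. ns l)"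
    using assms(1) by (intro sum_mono2) auto
  then show ?thesis using assms(2) by simp
qed

section \<open>Assembly of the blocks by conjugation with \<open>Q\<close>\<close>

theorem corollary4p2:
  fixes n k :: nat
    and p :: "real poly"
    and x y :: "complex vec"
    and A P Q :: "complex mat"
    and ns :: "nat \<Rightarrow> nat"
  assumes "1 \<le> n"
    and "p \<noteq> 0"
    and "x \<in> carrier_vec n"
    and "invertible_mat (diag_mat_of_vec x)"
    and "permutation_mat n P"
    and "A = diag_mat_of_vec x * P"
    and "nonneg_complex_mat A"
    and "permutation_mat n Q"
    and "1 \<le> k" and "k \<le> n"
    and "\<forall>i<k. 1 \<le> ns i"
    and "(\<Sum>i<k. ns i) = n"
    and "y = transpose_mat Q *\<^sub>v x"
    and "transpose_mat Q * A * Q = direct_sum_mat k (\<lambda>i. K_mat (vec_block y ns i))"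
  shows "poly_mat p A =
    Q * direct_sum_mat k (\<lambda>i.
          let z = vec_block y ns i; \<alpha> = Re (vec_prod z) in
          mat_sum (ns i)
            (\<lambda>r. complex_of_real
                   (poly (mod_part p r (ns i)) (\<alpha> powr (1 / real (ns i)))
                      / \<alpha> powr (real r / real (ns i)))
                 \<cdot>\<^sub>m (K_mat z ^\<^sub>m r))
            {0..<ns i})
      * transpose_mat Q"
proof -
  let ?z = "vec_block y ns"
  let ?B = "direct_sum_mat k (\<lambda>i. K_mat (?z i))"
  obtain \<tau> where \<tau>: "\<tau> permutes {..<n}" "Q = mat_of_perm n \<tau>"
    using assms(8) by (auto simp: permutation_mat_def)
  obtain \<sigma> where \<sigma>: "P = mat_of_perm n \<sigma>"
    using assms(5) by (auto simp: permutation_mat_def)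
  have Q: "Q \<in> carrier_mat n n" "transpose_mat Q \<in> carrier_mat n n"
    by (simp_all add: \<tau>(2))
  have A: "A \<in> carrier_mat n n"
    using assms(3)
    by (auto simp: assms(6) \<sigma> diag_mat_of_vec_def mat_of_perm_def mat_diag_def)
  have QQ: "Q * transpose_mat Q = 1\<^sub>m n" "transpose_mat Q * Q = 1\<^sub>m n"
    using mat_of_perm_transpose_mult[OF \<tau>(1)] by (simp_all add: \<tau>(2))
  have dim_z [simp]: "dim_vec (?z i) = ns i" for i
    by (simp add: vec_block_def)
  have K: "K_mat (?z i) \<in> carrier_mat (ns i) (ns i)" for i
    using K_mat_carrier[of "?z i"] by simp
  have B: "?B \<in> carrier_mat n n"
    using direct_sum_mat_carrier[of k "\<lambda>i. K_mat (?z i)" ns] K assms(12) by simp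
  \<comment> \<open>Inserting the identity on both sides of \<open>A\<close> exposes the given block
    form, so \<open>A\<close> is similar to \<open>?B\<close> and its powers are conjugates of
    powers of \<open>?B\<close>.\<close>
  have "A = (Q * transpose_mat Q) * A * (Q * transpose_mat Q)"
    using A by (simp add: QQ)
  also have "\<dots> = Q * (transpose_mat Q * A * Q) * transpose_mat Q"
    using A Q by (simp add: assoc_mult_mat[of _ n n _ n _ n])
  finally have A_eq: "A = Q * ?B * transpose_mat Q"
    by (simp add: assms(14))
  have pow: "A ^\<^sub>m j = Q * ?B ^\<^sub>m j * transpose_mat Q" for j
    by (rule similar_mat_wit_pow_id[OF similar_mat_witI[OF QQ A_eq A B Q]])
  have y_pos: "y $ j \<in> \<real>\<^sub>\<ge>\<^sub>0" "y $ j \<noteq> 0" if "j < n" for j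
  proof -
    \<comment> \<open>Every index of \<open>y\<close> is some \<open>\<tau> i\<close>, so every
      entry of \<open>y\<close> is an entry of \<open>x\<close>.\<close>
    have "j \<in> \<tau> ` {..<n}" using permutes_image[OF \<tau>(1)] that by simp
    then obtain i where i: "i < n" "j = \<tau> i" by auto
    then have "y $ j = x $ i"
      using transpose_mat_of_perm_mult_vec_index[OF \<tau>(1) assms(3), of i]
      by (simp add: assms(13) \<tau>(2))
    moreover have "x $ i \<in> \<real>\<^sub>\<ge>\<^sub>0"
      using diag_mat_of_vec_mult_perm_nonneg[OF assms(5,3) assms(7)[unfolded assms(6)] i(1)] .
    moreover have "x $ i \<noteq> 0"
      using invertible_diag_mat_of_vec_nonzero[OF assms(4)] i(1) assms(3) by simp
    ultimately show "y $ j \<in> \<real>\<^sub>\<ge>\<^sub>0" "y $ j \<noteq> 0" by simp_all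
  qed
  have z_pos: "?z i $ j \<in> \<real>\<^sub>\<ge>\<^sub>0" "?z i $ j \<noteq> 0" if "i < k" "j < ns i" for i j
    using y_pos sum_block_offset_less[of i k j ns] that assms(12)
    by (simp_all add: vec_block_def)
  \<comment> \<open>With the scalar moved inside the blocks, each term of
    \<open>poly_mat p A\<close> is a conjugated direct sum. The summation can then pass
    \<open>transpose_mat Q\<close>, \<open>Q\<close> and the direct sum in turn.\<close>
  have smult_pow: "c \<cdot>\<^sub>m (A ^\<^sub>m j)
      = Q * direct_sum_mat k (\<lambda>i. c \<cdot>\<^sub>m (K_mat (?z i) ^\<^sub>m j)) * transpose_mat Q" for c j
  proof -
    have "c \<cdot>\<^sub>m (A ^\<^sub>m j) = Q * (c \<cdot>\<^sub>m (?B ^\<^sub>m j)) * transpose_mat Q"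
      using Q pow_carrier_mat[OF B]
      by (simp add: pow mult_smult_distrib[of _ n n _ n] mult_smult_assoc_mat[of _ n n _ n])
    moreover have "?B ^\<^sub>m j = direct_sum_mat k (\<lambda>i. K_mat (?z i) ^\<^sub>m j)"
      by (rule direct_sum_mat_pow) (use carrier_matD[OF K] in simp)
    ultimately show ?thesis by (simp add: direct_sum_mat_smult)
  qed
  have blocks: "direct_sum_mat k (\<lambda>i. c \<cdot>\<^sub>m (K_mat (?z i) ^\<^sub>m j)) \<in> carrier_mat n n" for c j
    using direct_sum_mat_carrier[of k "\<lambda>i. c \<cdot>\<^sub>m (K_mat (?z i) ^\<^sub>m j)" ns]
      pow_carrier_mat[OF K] assms(12) by simp
  let ?F = "\<lambda>j i. complex_of_real (coeff p j) \<cdot>\<^sub>m (K_mat (?z i) ^\<^sub>m j)"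
  have "poly_mat p A
      = mat_sum n (\<lambda>j. Q * direct_sum_mat k (?F j) * transpose_mat Q) {..degree p}"
    using A by (simp add: poly_mat_def smult_pow)
  also have "\<dots> = mat_sum n (\<lambda>j. Q * direct_sum_mat k (?F j)) {..degree p} * transpose_mat Q"
    by (rule mat_sum_mult_right[OF Q(2)]) (rule mult_carrier_mat[OF Q(1) blocks])
  also have "mat_sum n (\<lambda>j. Q * direct_sum_mat k (?F j)) {..degree p}
      = Q * mat_sum n (\<lambda>j. direct_sum_mat k (?F j)) {..degree p}"
    by (rule mat_sum_mult_left[OF Q(1) blocks])
  also have "mat_sum n (\<lambda>j. direct_sum_mat k (?F j)) {..degree p}
      = direct_sum_mat k (\<lambda>i. mat_sum (ns i) (\<lambda>j. ?F j i) {..degree p})"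
    unfolding assms(12)[symmetric]
    by (rule mat_sum_direct_sum_mat) (simp add: pow_carrier_mat[OF K])
  also have "\<dots> = direct_sum_mat k (\<lambda>i.
          let z = vec_block y ns i; \<alpha> = Re (vec_prod z) in
          mat_sum (ns i)
            (\<lambda>r. complex_of_real
                   (poly (mod_part p r (ns i)) (\<alpha> powr (1 / real (ns i)))
                      / \<alpha> powr (real r / real (ns i)))
                 \<cdot>\<^sub>m (K_mat z ^\<^sub>m r))
            {0..<ns i})"
  proof (rule direct_sum_mat_cong)
    fix i assume i: "i < k"
    \<comment> \<open>Nonempty blocks make the residues modulo \<open>ns i\<close> and the root of
      order \<open>ns i\<close> meaningful.\<close>
    have "0 < ns i" using assms(11) i by force
    then show "mat_sum (ns i) (\<lambda>j. ?F j i) {..degree p} = (let z = ?z i; \<alpha> = Re (vec_prod z) in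
          mat_sum (ns i)
            (\<lambda>r. complex_of_real
                   (poly (mod_part p r (ns i)) (\<alpha> powr (1 / real (ns i)))
                      / \<alpha> powr (real r / real (ns i)))
                 \<cdot>\<^sub>m (K_mat z ^\<^sub>m r))
            {0..<ns i})"
      using poly_mat_K_mat[of "?z i" "Re (vec_prod (?z i))" p]
        vec_prod_pos_real[of "?z i"] z_pos[OF i]
      by (simp add: Let_def)
  qed
  finally show ?thesis .
qed

end
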